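(* We have $M_n=o(2^n)$ as $n\to\infty$. More precisely, there is a constant $c$ such that for all integers $n\ge 1$, $$M_n\le \frac{c\,2^n}{\sqrt{n}}.$$
   Context: All graphs are finite and simple. A matching is a set of edges no two of which share a vertex; $\nu(G)$ is the number of edges in a largest matching of $G$, and $m_k(G)$ is the number of matchings in $G$ with exactly $k$ edges. For a graph $G$ with $\nu(G)=n$, a permutation $\pi$ of $[n]=\{1,\ldots,n\}$ is a matching permutation of $G$ if $m_{\pi(1)}(G)\le m_{\pi(2)}(G)\le\cdots\le m_{\pi(n)}(G)$ (ties are allowed, so a graph may have several matching permutations). $M_n$ denotes the number of permutations of $[n]$ that are a matching permutation of some graph $G$ with $\nu(G)=n$. *)

theory Defs
  imports
    Complex_Main
    "HOL-Combinatorics.Permutations"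
    "HOL-Library.Landau_Symbols"
begin

definition simple_graph :: "'a set \<Rightarrow> 'a set set \<Rightarrow> bool" where
  "simple_graph V E \<longleftrightarrow> finite V \<and> (\<forall>e\<in>E. e \<subseteq> V \<and> card e = 2)"

text \<open>
  Matchings depend only on the edge set, so the vertex set is not a parameter of
  the following notions. The empty matching is included.
\<close>

definition matching :: "'a set set \<Rightarrow> 'a set set \<Rightarrow> bool" where
  "matching E M \<longleftrightarrow> M \<subseteq> E \<and> pairwise disjnt M"

definition matching_number :: "'a set set \<Rightarrow> nat" where
  "matching_number E = Max {card M | M. matching E M}"

definition num_matchings :: "'a set set \<Rightarrow> nat \<Rightarrow> nat" where
  "num_matchings E k = card {M. matching E M \<and> card M = k}"

definition matching_permutation :: "'a set set \<Rightarrow> (nat \<Rightarrow> nat) \<Rightarrow> bool" where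
  "matching_permutation E \<pi> \<longleftrightarrow>
     \<pi> permutes {1..matching_number E} \<and>
     mono_on {1..matching_number E} (\<lambda>i. num_matchings E (\<pi> i))"

text \<open>
  Restricting to graphs whose vertices are natural numbers loses nothing, as every
  finite graph is isomorphic to such a graph; see \<open>matching_permutation_in_matching_perms\<close>.
\<close>

definition matching_perms :: "nat \<Rightarrow> (nat \<Rightarrow> nat) set" where
  "matching_perms n =
     {\<pi>. \<exists>(V :: nat set) E. simple_graph V E \<and> matching_number E = n \<and> matching_permutation E \<pi>}"

definition num_matching_perms :: "nat \<Rightarrow> nat" where
  "num_matching_perms n = card (matching_perms n)"

lemma simple_graph_iso:
  assumes G: "simple_graph V E" and f: "inj_on f V"
  shows "simple_graph (f ` V) ((`) f ` E)"
    and "matching_number ((`) f ` E) = matching_number E"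
    and "num_matchings ((`) f ` E) k = num_matchings E k"
proof -
  have EV: "E \<subseteq> Pow V" using G by (auto simp: simple_graph_def)
  have f': "inj_on ((`) f) E"
    using inj_on_subset[OF inj_on_image_Pow[OF f] EV] .
  show "simple_graph (f ` V) ((`) f ` E)"
    using G f unfolding simple_graph_def
    by (auto simp: card_image inj_on_subset)
  have card_eq: "card ((`) f ` M) = card M" if "M \<subseteq> E" for M
    by (meson card_image f' inj_on_subset that)
  have disj: "disjnt (f ` a) (f ` b) \<longleftrightarrow> disjnt a b" if "a \<in> E" "b \<in> E" for a b
    using that EV f unfolding disjnt_def
    by (metis PowD image_is_empty inj_on_image_Int subsetD)
  have mat: "matching ((`) f ` E) ((`) f ` M) \<longleftrightarrow> matching E M" if M: "M \<subseteq> E" for M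
  proof -
    have ne: "f ` a \<noteq> f ` b \<longleftrightarrow> a \<noteq> b" if "a \<in> M" "b \<in> M" for a b
      using f' M that by (meson inj_on_def subsetD)
    show ?thesis
      using M ne disj unfolding matching_def pairwise_def
      by (smt (verit) imageE image_eqI image_mono subsetD)
  qed
  have img: "{M. matching ((`) f ` E) M \<and> P (card M)}
      = ((`) ((`) f)) ` {M. matching E M \<and> P (card M)}" (is "?L = ?R") for P
  proof
    show "?L \<subseteq> ?R"
    proof
      fix N assume N: "N \<in> ?L"
      then have "N \<subseteq> (`) f ` E" by (simp add: matching_def)
      then obtain M where "M \<subseteq> E" "N = (`) f ` M" by (meson subset_imageE)
      with N show "N \<in> ?R" using mat card_eq by auto
    qed
    show "?R \<subseteq> ?L"
    proof
      fix N assume "N \<in> ?R"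
      then obtain M where "matching E M" "P (card M)" "N = (`) f ` M" by blast
      moreover from this have "M \<subseteq> E" by (simp add: matching_def)
      ultimately show "N \<in> ?L" using mat card_eq by simp
    qed
  qed
  have "{card M | M. matching ((`) f ` E) M} = card ` {M. matching ((`) f ` E) M}"
    by blast
  also have "\<dots> = card ` {M. matching E M}"
    using img[of "\<lambda>_. True"] card_eq by (force simp: matching_def image_image)
  also have "\<dots> = {card M | M. matching E M}" by blast
  finally show "matching_number ((`) f ` E) = matching_number E"
    by (simp add: matching_number_def)
  have "inj_on ((`) ((`) f)) {M. matching E M \<and> card M = k}"
    by (rule inj_on_subset[OF inj_on_image_Pow[OF f']]) (auto simp: matching_def)
  then show "num_matchings ((`) f ` E) k = num_matchings E k"
    unfolding num_matchings_def using img[of "\<lambda>c. c = k"] by (simp add: card_image)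
qed

lemma matching_permutation_in_matching_perms:
  fixes V :: "'a set"
  assumes "simple_graph V E" and "matching_permutation E \<pi>"
  shows "\<pi> \<in> matching_perms (matching_number E)"
proof -
  obtain f :: "'a \<Rightarrow> nat" where f: "inj_on f V"
    using assms(1) finite_imp_inj_to_nat_seg unfolding simple_graph_def by metis
  note iso = simple_graph_iso[OF assms(1) f]
  have "matching_permutation ((`) f ` E) \<pi>"
    using assms(2) by (simp add: matching_permutation_def iso)
  then show ?thesis
    unfolding matching_perms_def using iso(1,2) by blast
qed

end

theory Submission
  imports Defs
begin

text \<open>
  Two facts about the numbers \<open>m\<^sub>k\<close> of \<open>k\<close>-matchings of a graph with matching number \<open>n\<close>
  restrict the matching permutations.

  The sequence is strictly log-concave, hence unimodal without long plateaus
  (\<open>num_matchings_interlacing\<close>, \<open>strictly_log_concave_imp_unimodal\<close>). A permutation that lists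
  the indices by increasing \<open>m\<^sub>k\<close> therefore removes at each step an end of the remaining interval,
  and is encoded by the word of left and right removals. This alone leaves \<open>2\<^sup>n\<^sup>-\<^sup>1\<close>
  possibilities.

  The sequence is also tilted to the right: \<open>m\<^sub>i < m\<^sub>j\<close> whenever \<open>i < j\<close> and \<open>i + j < n\<close>
  (\<open>num_matchings_less_reflected\<close>). The reason is that, relative to a maximum matching, the
  matching polynomial is a sum of polynomials \<open>x\<^sup>c (1 + x)\<^sup>u\<close>, each symmetric about a centre that
  is at least \<open>n/2\<close>.

  The tilt means that right removals can never outnumber left removals by more than two
  (\<open>card_right_le_card_left\<close>), so the word is a ballot word. By the reflection principle
  there are at most three times the middle binomial coefficient of such words
  (\<open>card_ballot_2_le\<close>), and that coefficient is at most \<open>2\<^sup>n / \<surd>n\<close>.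
\<close>

section \<open>The matching sequence is tilted to the right\<close>

lemma finite_matchings: "finite E \<Longrightarrow> finite {M. matching E M \<and> P M}"
  by (rule finite_subset[of _ "Pow E"]) (auto simp: matching_def)

lemma binomial_less_if_add_less:
  fixes a b u :: nat
  assumes "a < b" "a + b < u"
  shows "u choose a < u choose b"
proof (cases "2 * b \<le> u")
  case True
  then show ?thesis using assms by (intro binomial_strict_mono) auto
next
  case False
  have "u choose a < u choose (u - b)"
    using assms False by (intro binomial_strict_mono) auto
  also have "u choose (u - b) = u choose b"
    using assms by (intro binomial_symmetric[symmetric]) auto
  finally show ?thesis .
qed

lemma card_met_by_le_card_Union:
  assumes "pairwise disjnt N" "finite X"
  shows "card {e\<in>N. \<not> disjnt e X} \<le> card X"
proof -
  define f where "f e = (SOME x. x \<in> e \<inter> X)" for e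
  have f: "f e \<in> e \<inter> X" if "e \<in> {e\<in>N. \<not> disjnt e X}" for e
    unfolding f_def using that by (intro someI_ex[of "\<lambda>x. x \<in> e \<inter> X"]) (auto simp: disjnt_def)
  have "inj_on f {e\<in>N. \<not> disjnt e X}"
  proof (rule inj_onI)
    fix d e assume de: "d \<in> {e\<in>N. \<not> disjnt e X}" "e \<in> {e\<in>N. \<not> disjnt e X}" "f d = f e"
    then have "f d \<in> d \<inter> e" using f[OF de(1)] f[OF de(2)] by auto
    then have "\<not> disjnt d e" by (auto simp: disjnt_def)
    then show "d = e" using assms(1) de by (auto simp: pairwise_def)
  qed
  then show ?thesis
    by (rule card_inj_on_le) (use f assms in auto)
qed

text \<open>
  Fix a matching \<open>N\<close> and sort the matchings \<open>M\<close> by their core \<open>M - N\<close>. Once the core is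
  chosen, \<open>M \<inter> N\<close> may be any set of \<open>N\<close>-edges that miss the core, so the matchings with a
  given core contribute \<open>x\<^sup>c (1 + x)\<^sup>u\<close> to the matching polynomial, where \<open>c\<close> is the size of
  the core and \<open>u\<close> the number of \<open>N\<close>-edges that miss it.
\<close>

lemma card_matchings_with_core:
  assumes fin: "finite E" and N: "matching E N" and M0: "matching E M0" "M0 \<inter> N = {}"
  shows "card {M. matching E M \<and> card M = k \<and> M - N = M0} =
    (if card M0 \<le> k then card {e\<in>N. disjnt e (\<Union>M0)} choose (k - card M0) else 0)"
proof -
  define F where "F = {e\<in>N. disjnt e (\<Union>M0)}"
  have fins: "finite N" "finite M0" "finite F"
    using N M0 fin by (auto simp: matching_def F_def intro: finite_subset)
  have FN: "F \<subseteq> N" by (auto simp: F_def)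
  have M0F: "M0 \<inter> F = {}" using M0 FN by auto
  have cardU: "card (M0 \<union> D) = card M0 + card D" if "D \<subseteq> F" for D
    using that fins M0F by (intro card_Un_disjoint) (auto intro: finite_subset)
  have mat: "matching E (M0 \<union> D)" if D: "D \<subseteq> F" for D
  proof -
    have "disjnt a b" if "a \<in> D" "b \<in> M0" for a b
      using that D by (auto simp: F_def disjnt_def)
    then show ?thesis
      using M0(1) N D FN unfolding matching_def pairwise_def
      by (smt (verit) UnE Un_subset_iff disjnt_sym subsetD subset_trans)
  qed
  have eq: "{M. matching E M \<and> card M = k \<and> M - N = M0} =
      (\<union>) M0 ` {D. D \<subseteq> F \<and> card M0 + card D = k}" (is "?L = ?R")
  proof
    show "?L \<subseteq> ?R"
    proof
      fix M assume "M \<in> ?L"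
      then have M: "matching E M" "card M = k" "M - N = M0" by auto
      have "disjnt e d" if "e \<in> M \<inter> N" "d \<in> M0" for e d
        using pairwiseD[of disjnt M e d] that M by (auto simp: matching_def)
      then have sub: "M \<inter> N \<subseteq> F" by (auto simp: F_def disjnt_def)
      have "M = M0 \<union> (M \<inter> N)" using M by auto
      moreover from this have "card M0 + card (M \<inter> N) = k" using cardU[OF sub] M by simp
      ultimately show "M \<in> ?R" using sub by blast
    qed
    show "?R \<subseteq> ?L"
      using cardU mat M0 FN by auto
  qed
  have "inj_on ((\<union>) M0) {D. D \<subseteq> F \<and> card M0 + card D = k}"
    using M0F by (auto simp: inj_on_def)
  then have "card ?L = card {D. D \<subseteq> F \<and> card M0 + card D = k}"
    unfolding eq by (rule card_image)
  also have "\<dots> = (if card M0 \<le> k then card F choose (k - card M0) else 0)"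
  proof (cases "card M0 \<le> k")
    case True
    then have "{D. D \<subseteq> F \<and> card M0 + card D = k} = {D. D \<subseteq> F \<and> card D = k - card M0}" by auto
    then show ?thesis using True n_subsets[OF fins(3)] by simp
  next
    case False
    then have "{D. D \<subseteq> F \<and> card M0 + card D = k} = {}" by auto
    then show ?thesis using False by simp
  qed
  finally show ?thesis by (simp add: F_def)
qed

text \<open>
  Summing over the cores relative to a matching \<open>N\<close> with \<open>n\<close> edges writes the matching
  polynomial as a sum of terms \<open>x\<^sup>c (1 + x)\<^sup>u\<close>. The \<open>2c\<close> vertices of the core meet at most
  \<open>2c\<close> edges of \<open>N\<close>, so \<open>n - u \<le> 2c\<close>, which says that the centre of symmetry \<open>c + u/2\<close> of
  each term is at least \<open>n/2\<close>. As \<open>(i + j)/2 < n/2\<close>, the index \<open>j\<close> is nearer to every one of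
  these centres than \<open>i\<close>. The empty core gives \<open>(1 + x)\<^sup>n\<close>, for which the inequality is strict.
\<close>

lemma num_matchings_less_reflected:
  assumes fin: "finite E" and two: "\<And>e. e \<in> E \<Longrightarrow> card e = 2"
    and N: "matching E N" "card N = n" and ij: "i < j" "i + j < n"
  shows "num_matchings E i < num_matchings E j"
proof -
  define C where "C = {M0. matching E M0 \<and> M0 \<inter> N = {}}"
  define fib where "fib k M0 = {M. matching E M \<and> card M = k \<and> M - N = M0}" for k M0
  have finC: "finite C" using finite_matchings[OF fin] by (simp add: C_def)
  have fin_fib: "finite (fib k M0)" for k M0
    using finite_matchings[OF fin] by (simp add: fib_def)
  have split: "num_matchings E k = (\<Sum>M0\<in>C. card (fib k M0))" for k
  proof -
    have "{M. matching E M \<and> card M = k} = (\<Union>M0\<in>C. fib k M0)"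
    proof (intro equalityI subsetI)
      fix M assume M: "M \<in> {M. matching E M \<and> card M = k}"
      then have "matching E (M - N)" by (auto simp: matching_def intro: pairwise_subset)
      then have "M - N \<in> C" by (auto simp: C_def)
      moreover have "M \<in> fib k (M - N)" using M by (simp add: fib_def)
      ultimately show "M \<in> (\<Union>M0\<in>C. fib k M0)" by blast
    qed (auto simp: fib_def)
    moreover have "card (\<Union>M0\<in>C. fib k M0) = (\<Sum>M0\<in>C. card (fib k M0))"
    proof (rule card_UN_disjoint)
      show "\<forall>A\<in>C. \<forall>B\<in>C. A \<noteq> B \<longrightarrow> fib k A \<inter> fib k B = {}"
        unfolding fib_def by blast
    qed (use finC fin_fib in auto)
    ultimately show ?thesis by (simp add: num_matchings_def)
  qed
  have fins: "finite N" using N fin by (auto simp: matching_def intro: finite_subset)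
  have many_free: "n \<le> card {e\<in>N. disjnt e (\<Union>M0)} + 2 * card M0" if "M0 \<in> C" for M0
  proof -
    have M0: "M0 \<subseteq> E" "finite M0" using that fin by (auto simp: C_def matching_def intro: finite_subset)
    have c2: "card e = 2" "finite e" if "e \<in> M0" for e
      using that M0 two[of e] card_ge_0_finite[of e] by auto
    have "card (\<Union>M0) \<le> (\<Sum>e\<in>M0. card e)" using M0 c2 by (intro card_Union_le_sum_card)
    also have "\<dots> = 2 * card M0" using c2 by simp
    finally have "card {e\<in>N. \<not> disjnt e (\<Union>M0)} \<le> 2 * card M0"
      using card_met_by_le_card_Union[of N "\<Union>M0"] N M0(2) c2(2) unfolding matching_def
      by (meson finite_Union le_trans)
    moreover have "card N = card {e\<in>N. disjnt e (\<Union>M0)} + card {e\<in>N. \<not> disjnt e (\<Union>M0)}"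
    proof -
      have "N = {e\<in>N. disjnt e (\<Union>M0)} \<union> {e\<in>N. \<not> disjnt e (\<Union>M0)}" by blast
      also have "card \<dots> = card {e\<in>N. disjnt e (\<Union>M0)} + card {e\<in>N. \<not> disjnt e (\<Union>M0)}"
        using fins by (intro card_Un_disjoint) (simp, simp, blast)
      finally show ?thesis .
    qed
    ultimately show ?thesis using N by simp
  qed
  have card_fib: "card (fib k M0) =
      (if card M0 \<le> k then card {e\<in>N. disjnt e (\<Union>M0)} choose (k - card M0) else 0)"
    if "M0 \<in> C" for k M0
    using that card_matchings_with_core[OF fin N(1)] by (auto simp: C_def fib_def)
  have less: "card (fib i M0) < card (fib j M0)" if "M0 \<in> C" "card M0 \<le> i" for M0
    using that ij many_free[OF that(1)] unfolding card_fib[OF that(1)]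
    by (auto intro!: binomial_less_if_add_less)
  show ?thesis
    unfolding split
  proof (rule sum_strict_mono_ex1[OF finC])
    show "\<forall>M0\<in>C. card (fib i M0) \<le> card (fib j M0)"
      using less card_fib by (metis le0 less_imp_le)
    have "{} \<in> C" by (auto simp: C_def matching_def)
    then show "\<exists>M0\<in>C. card (fib i M0) < card (fib j M0)" using less[of "{}"] by auto
  qed
qed

section \<open>The matching sequence is strictly log-concave\<close>

definition induced :: "'a set set \<Rightarrow> 'a set \<Rightarrow> 'a set set" where
  "induced E W = {e\<in>E. e \<subseteq> W}"

lemma num_matchings_0: "finite E \<Longrightarrow> num_matchings E 0 = 1"
proof -
  assume "finite E"
  then have "{M. matching E M \<and> card M = 0} = {{}}"
    by (auto simp: matching_def dest: finite_subset)
  then show ?thesis by (simp add: num_matchings_def)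
qed

lemma num_matchings_mono:
  "finite E \<Longrightarrow> E' \<subseteq> E \<Longrightarrow> num_matchings E' k \<le> num_matchings E k"
  unfolding num_matchings_def
  by (intro card_mono finite_matchings) (auto simp: matching_def)

lemma num_matchings_pos_iff:
  "finite E \<Longrightarrow> 0 < num_matchings E k \<longleftrightarrow> (\<exists>M. matching E M \<and> card M = k)"
  unfolding num_matchings_def using finite_matchings[of E "\<lambda>M. card M = k"]
  by (auto simp: card_gt_0_iff)

lemma num_matchings_pos_le:
  assumes fin: "finite E" and "0 < num_matchings E l" "k \<le> l"
  shows "0 < num_matchings E k"
proof -
  obtain M where M: "matching E M" "card M = l" using assms num_matchings_pos_iff by blast
  then obtain M' where M': "M' \<subseteq> M" "card M' = k"
    using assms(3) obtain_subset_with_card_n by metis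
  then have "matching E M'" using M by (auto simp: matching_def intro: pairwise_subset)
  then show ?thesis using M' num_matchings_pos_iff[OF fin] by blast
qed

text \<open>
  A matching either misses \<open>v\<close> or uses exactly one edge \<open>{v, w}\<close>.
\<close>

lemma num_matchings_vertex_deletion:
  assumes fin: "finite E" "finite W" and two: "\<And>e. e \<in> E \<Longrightarrow> card e = 2" and v: "v \<in> W"
  shows "num_matchings (induced E W) (Suc k) = num_matchings (induced E (W - {v})) (Suc k) +
     (\<Sum>w\<in>{w\<in>W - {v}. {v, w} \<in> E}. num_matchings (induced E (W - {v} - {w})) k)"
proof -
  define A where "A = {M. matching (induced E W) M \<and> card M = Suc k}"
  define nb where "nb = {w\<in>W - {v}. {v, w} \<in> E}"
  define A0 where "A0 = {M. matching (induced E (W - {v})) M \<and> card M = Suc k}"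
  define A1 where "A1 w = {M\<in>A. {v, w} \<in> M}" for w
  have finI: "finite (induced E X)" for X using fin by (auto simp: induced_def)
  have finA: "finite A" "finite A0" "\<And>w. finite (A1 w)" and finnb: "finite nb"
    using finite_matchings[OF finI] fin by (auto simp: A_def A0_def A1_def nb_def)
  have A_eq: "A = A0 \<union> (\<Union>w\<in>nb. A1 w)"
  proof
    show "A \<subseteq> A0 \<union> (\<Union>w\<in>nb. A1 w)"
    proof
      fix M assume M: "M \<in> A"
      show "M \<in> A0 \<union> (\<Union>w\<in>nb. A1 w)"
      proof (cases "v \<in> \<Union>M")
        case True
        then obtain e where e: "e \<in> M" "v \<in> e" by auto
        then have eE: "e \<in> E" "e \<subseteq> W" using M by (auto simp: A_def matching_def induced_def)
        then obtain w where w: "e = {v, w}" "w \<noteq> v"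
          using two[OF eE(1)] e(2) by (auto simp: card_2_iff doubleton_eq_iff)
        then have "w \<in> nb" "M \<in> A1 w" using e eE M by (auto simp: nb_def A1_def)
        then show ?thesis by blast
      next
        case False
        then have "M \<in> A0" using M by (auto simp: A_def A0_def matching_def induced_def)
        then show ?thesis by blast
      qed
    qed
    show "A0 \<union> (\<Union>w\<in>nb. A1 w) \<subseteq> A"
      by (auto simp: A_def A0_def A1_def matching_def induced_def)
  qed
  have disj0: "A0 \<inter> (\<Union>w\<in>nb. A1 w) = {}"
    by (auto simp: A0_def A1_def matching_def induced_def)
  have disj1: "A1 w \<inter> A1 w' = {}" if "w \<noteq> w'" for w w'
  proof -
    have "{v, w} \<noteq> {v, w'}" "\<not> disjnt {v, w} {v, w'}" using that by (auto simp: doubleton_eq_iff)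
    then have "\<not> ({v, w} \<in> M \<and> {v, w'} \<in> M)" if "matching X M" for X M
      using that pairwiseD[of disjnt M "{v, w}" "{v, w'}"] unfolding matching_def by blast
    then show ?thesis
      unfolding A1_def A_def by blast
  qed
  have card1: "card (A1 w) = num_matchings (induced E (W - {v} - {w})) k" if w: "w \<in> nb" for w
  proof -
    define B where "B = {M. matching (induced E (W - {v} - {w})) M \<and> card M = k}"
    have finM: "finite M" if "matching (induced E X) M" for X M
      using that finI[of X] finite_subset by (auto simp: matching_def)
    have vw: "{v, w} \<in> induced E W" using w v by (auto simp: nb_def induced_def)
    have notin: "{v, w} \<notin> M" if "M \<in> B" for M
      using that by (auto simp: B_def matching_def induced_def)
    have "A1 w = insert {v, w} ` B"
    proof
      show "A1 w \<subseteq> insert {v, w} ` B"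
      proof
        fix M assume M: "M \<in> A1 w"
        have Mm: "matching (induced E W) M" "card M = Suc k" "{v, w} \<in> M"
          using M by (auto simp: A1_def A_def)
        have "e \<subseteq> W - {v} - {w}" if "e \<in> M - {{v, w}}" for e
        proof -
          have "disjnt e {v, w}" using that Mm pairwiseD[of disjnt M e "{v, w}"] by (auto simp: matching_def)
          moreover have "e \<subseteq> W" using that Mm by (auto simp: matching_def induced_def)
          ultimately show ?thesis by (auto simp: disjnt_def)
        qed
        then have "matching (induced E (W - {v} - {w})) (M - {{v, w}})"
          using Mm(1) unfolding matching_def induced_def by (blast intro: pairwise_subset)
        moreover have "card (M - {{v, w}}) = k" using Mm finM[OF Mm(1)] by simp
        ultimately show "M \<in> insert {v, w} ` B"
          using Mm by (intro image_eqI[of _ _ "M - {{v, w}}"]) (auto simp: B_def)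
      qed
      show "insert {v, w} ` B \<subseteq> A1 w"
      proof
        fix M' assume "M' \<in> insert {v, w} ` B"
        then obtain M where M: "M \<in> B" "M' = insert {v, w} M" by auto
        have sub: "M \<subseteq> induced E (W - {v} - {w})" and pw: "pairwise disjnt M"
          and c: "card M = k" "finite M"
          using M finM by (auto simp: B_def matching_def)
        have "disjnt e {v, w}" if "e \<in> M" for e
          using that sub by (auto simp: induced_def disjnt_def)
        then have "pairwise disjnt M'" using pw M by (auto simp: pairwise_insert disjnt_sym)
        moreover have "M' \<subseteq> induced E W" using sub vw M by (auto simp: induced_def)
        moreover have "card M' = Suc k" using c notin[OF M(1)] M by simp
        ultimately show "M' \<in> A1 w" using M by (auto simp: A1_def A_def matching_def)
      qed
    qed
    moreover have "inj_on (insert {v, w}) B"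
      using notin by (auto simp: inj_on_def insert_ident)
    ultimately show ?thesis by (simp add: card_image B_def num_matchings_def)
  qed
  have "card A = card A0 + card (\<Union>w\<in>nb. A1 w)"
    unfolding A_eq using finA finnb disj0 by (intro card_Un_disjoint) auto
  also have "card (\<Union>w\<in>nb. A1 w) = (\<Sum>w\<in>nb. card (A1 w))"
    using finA finnb disj1 by (intro card_UN_disjoint) auto
  also have "\<dots> = (\<Sum>w\<in>nb. num_matchings (induced E (W - {v} - {w})) k)"
    using card1 by (intro sum.cong) auto
  finally show ?thesis by (simp add: A_def A0_def num_matchings_def nb_def)
qed

definition strictly_log_concave :: "(nat \<Rightarrow> nat) \<Rightarrow> bool" where
  "strictly_log_concave f \<longleftrightarrow>
     (\<forall>k. f (Suc k) > 0 \<longrightarrow> f (Suc (Suc k)) * f k < f (Suc k) * f (Suc k))"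

text \<open>
  Wherever the quotients make sense, the first two conjuncts say that the ratio
  \<open>f (k + 1) / f k\<close> lies between \<open>g (k + 1) / g k\<close> and \<open>g k / g (k - 1)\<close>. These are
  inequalities between coefficients that follow from interlacing of the zeros in the real-rooted
  setting. For fixed \<open>g\<close> the two weak inequalities are linear in \<open>f\<close>, and for fixed \<open>f\<close> they
  are linear in \<open>g\<close>; this is what lets them survive the sum in the vertex deletion recurrence,
  whereas log-concavity alone would not. Products replace quotients because the sequences vanish
  eventually.
\<close>

definition interlaces :: "(nat \<Rightarrow> nat) \<Rightarrow> (nat \<Rightarrow> nat) \<Rightarrow> bool" where
  "interlaces g f \<longleftrightarrow>
     (\<forall>k. f k * g (Suc k) \<le> f (Suc k) * g k \<and>
       f (Suc (Suc k)) * g k \<le> f (Suc k) * g (Suc k) \<and>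
       (g (Suc k) > 0 \<longrightarrow> f (Suc (Suc k)) * g k < f (Suc k) * g (Suc k)))"

text \<open>
  One index of the passage from \<open>g\<close> and \<open>h\<close> to \<open>f = g + x h\<close>: log-concavity of \<open>g\<close> and the
  first half of interlacing for \<open>h\<close> and \<open>g\<close> combine to the second half for \<open>g\<close> and \<open>f\<close>.
\<close>

lemma log_concave_step:
  fixes f1 f2 g0 g1 g2 h0 h1 :: nat
  assumes "g1 > 0 \<Longrightarrow> g2 * g0 < g1 * g1" "h1 * g0 \<le> h0 * g1" "f1 = g1 + h0" "f2 = g2 + h1"
    and "g1 = 0 \<Longrightarrow> g2 = 0"
  shows "f2 * g0 \<le> f1 * g1" "g1 > 0 \<Longrightarrow> f2 * g0 < f1 * g1"
proof -
  show s: "f2 * g0 < f1 * g1" if "g1 > 0"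
    using assms(1)[OF that] assms(2) unfolding assms(3,4) by (simp add: algebra_simps)
  show "f2 * g0 \<le> f1 * g1"
    using s assms by (cases "g1 = 0") auto
qed

text \<open>
  Consecutive ratios of \<open>f\<close> are separated by a ratio of \<open>g\<close>:
  \<open>f\<^sub>2 / f\<^sub>1 < g\<^sub>1 / g\<^sub>0 \<le> f\<^sub>1 / f\<^sub>0\<close>. If \<open>g\<^sub>1 = 0\<close>, then interlacing forces \<open>f\<^sub>2 = 0\<close>.
\<close>

lemma log_concave_from_interlacing:
  fixes f0 f1 f2 g0 g1 :: nat
  assumes A: "f0 * g1 \<le> f1 * g0" and B: "f2 * g0 \<le> f1 * g1" "g1 > 0 \<Longrightarrow> f2 * g0 < f1 * g1"
    and pos: "f1 > 0" "g0 > 0"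
  shows "f2 * f0 < f1 * f1"
proof (cases "g1 = 0")
  case True
  then show ?thesis using B(1) pos by auto
next
  case False
  then have "(f2 * f0) * (g0 * g1) \<le> (f2 * g0) * (f1 * g0)"
    using mult_left_mono[OF A, of "f2 * g0"] by (simp add: algebra_simps)
  also have "\<dots> < (f1 * g1) * (f1 * g0)"
    using B(2) False pos by simp
  also have "\<dots> = (f1 * f1) * (g0 * g1)" by (simp add: algebra_simps)
  finally show ?thesis by simp
qed

text \<open>
  A combinatorial substitute for the theorem of Heilmann and Lieb that matching polynomials are
  real-rooted. With \<open>f\<close>, \<open>g\<close> and \<open>h\<close> the matching sequences of \<open>W\<close>, of \<open>W - {v}\<close> and the
  sum of those of \<open>W - {v} - {w}\<close> over the neighbours \<open>w\<close> of \<open>v\<close>, the recurrence reads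
  \<open>f = g + x h\<close>. By induction \<open>g\<close> is log-concave and interlaced by every summand of \<open>h\<close>, hence
  by \<open>h\<close>. This gives that \<open>g\<close> interlaces \<open>f\<close>, which in turn makes \<open>f\<close> log-concave.
\<close>

lemma num_matchings_interlacing:
  fixes E :: "'a set set"
  assumes fin: "finite E" and two: "\<And>e. e \<in> E \<Longrightarrow> card e = 2" and "finite W"
  defines "m \<equiv> \<lambda>W. num_matchings (induced E W)"
  shows "strictly_log_concave (m W) \<and> (\<forall>v\<in>W. interlaces (m (W - {v})) (m W))"
  using \<open>finite W\<close>
proof (induction W rule: finite_psubset_induct)
  case (psubset W)
  have finI: "finite (induced E X)" for X using fin by (auto simp: induced_def)
  have m0: "m X 0 = 1" for X using num_matchings_0[OF finI] by (simp add: m_def)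
  have down: "m X (Suc k) > 0 \<Longrightarrow> m X k > 0" for X k
    using num_matchings_pos_le[OF finI] by (auto simp: m_def)
  define g where "g v = m (W - {v})" for v
  define h where "h v w = m (W - {v} - {w})" for v w
  define H where "H v k = (\<Sum>w\<in>{w\<in>W - {v}. {v, w} \<in> E}. h v w k)" for v k
  have rec: "m W (Suc k) = g v (Suc k) + H v k" if "v \<in> W" for v k
    unfolding m_def g_def h_def H_def
    by (rule num_matchings_vertex_deletion[OF fin psubset(1) two that])
  have le: "h v w k \<le> g v k" for v w k
    unfolding m_def g_def h_def by (rule num_matchings_mono[OF finI]) (auto simp: induced_def)
  have LCg: "g v (Suc k) > 0 \<Longrightarrow> g v (Suc (Suc k)) * g v k < g v (Suc k) * g v (Suc k)"
    if "v \<in> W" for v k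
    using psubset.IH[of "W - {v}"] that by (auto simp: g_def strictly_log_concave_def)
  have Ag: "g v k * h v w (Suc k) \<le> g v (Suc k) * h v w k"
    and Bg: "g v (Suc (Suc k)) * h v w k \<le> g v (Suc k) * h v w (Suc k)"
    if "v \<in> W" "w \<in> W - {v}" for v w k
    using psubset.IH[of "W - {v}"] that by (auto simp: g_def h_def interlaces_def)
  have HA: "H v (Suc k) * g v k \<le> H v k * g v (Suc k)" if v: "v \<in> W" for v k
    unfolding H_def sum_distrib_right
    using Ag[OF v] by (intro sum_mono) (simp add: mult.commute)
  have HB: "H v k * g v (Suc (Suc k)) \<le> H v (Suc k) * g v (Suc k)" if v: "v \<in> W" for v k
    unfolding H_def sum_distrib_right
    using Bg[OF v] by (intro sum_mono) (simp add: mult.commute)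
  \<comment> \<open>The two halves of interlacing trade places: the second half for \<open>h\<close> and \<open>g\<close> gives the first
    half for \<open>g\<close> and \<open>f\<close>; with log-concavity of \<open>g\<close>, the first gives the second.\<close>
  have A: "m W k * g v (Suc k) \<le> m W (Suc k) * g v k" if v: "v \<in> W" for v k
  proof (cases k)
    case 0
    then show ?thesis using rec[OF v, of 0] m0 by (simp add: g_def)
  next
    case (Suc l)
    then show ?thesis
      using HB[OF v, of l] by (simp add: rec[OF v] algebra_simps)
  qed
  have zero: "g v k = 0 \<Longrightarrow> H v k = 0" for v k
    using le[of v _ k] by (simp add: H_def)
  have B: "m W (Suc (Suc k)) * g v k \<le> m W (Suc k) * g v (Suc k)"
    and B': "g v (Suc k) > 0 \<Longrightarrow> m W (Suc (Suc k)) * g v k < m W (Suc k) * g v (Suc k)"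
    if v: "v \<in> W" for v k
  proof -
    have "g v (Suc k) = 0 \<Longrightarrow> g v (Suc (Suc k)) = 0"
      using down[of "W - {v}" "Suc k"] by (auto simp: g_def)
    note step = log_concave_step[OF LCg[OF v] HA[OF v] rec[OF v] rec[OF v] this]
    show "m W (Suc (Suc k)) * g v k \<le> m W (Suc k) * g v (Suc k)" by (rule step(1))
    show "g v (Suc k) > 0 \<Longrightarrow> m W (Suc (Suc k)) * g v k < m W (Suc k) * g v (Suc k)"
      by (rule step(2))
  qed
  have LC: "m W (Suc (Suc k)) * m W k < m W (Suc k) * m W (Suc k)" if pos: "m W (Suc k) > 0" for k
  proof -
    obtain M where M: "matching (induced E W) M" "card M = Suc k"
      using pos num_matchings_pos_iff[OF finI] by (auto simp: m_def)
    then obtain e where "e \<in> M" by fastforce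
    then have "e \<subseteq> W" "card e = 2" using M two by (auto simp: matching_def induced_def)
    then obtain v where v: "v \<in> W" by fastforce
    have "g v k > 0"
    proof (rule ccontr)
      assume "\<not> g v k > 0"
      then have "g v k = 0" "g v (Suc k) = 0" using down[of "W - {v}" k] by (auto simp: g_def)
      then show False using pos zero by (simp add: rec[OF v])
    qed
    with A[OF v] B[OF v] B'[OF v] pos show ?thesis
      by (rule log_concave_from_interlacing)
  qed
  show ?case
    using A B B' LC by (simp add: g_def strictly_log_concave_def interlaces_def)
qed

text \<open>
  Strictness excludes plateaus of length three. It is needed because tied terms may be listed in
  either order: a sequence with three equal consecutive terms would admit orderings in which the
  middle one comes first.
\<close>

lemma strictly_log_concave_imp_unimodal:
  fixes a :: "nat \<Rightarrow> nat"
  assumes lc: "strictly_log_concave a" and pos: "\<And>t. t \<le> n \<Longrightarrow> a t > 0"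
    and ijk: "i < j" "j < k" "k \<le> n"
  shows "a i < a j \<or> a k < a j"
proof (rule ccontr)
  assume "\<not> ?thesis"
  then have ge: "a j \<le> a i" "a j \<le> a k" by auto
  have "\<exists>t. i \<le> t \<and> t < j \<and> a (Suc t) \<le> a t"
  proof (rule ccontr)
    assume none: "\<not> ?thesis"
    have "i + Suc d \<le> j \<Longrightarrow> a i < a (i + Suc d)" for d
    proof (induction d)
      case (Suc d)
      have "a (i + Suc d) < a (Suc (i + Suc d))"
        using none Suc.prems by (metis Suc_le_lessD add_Suc_right le_add1 not_less)
      then show ?case using Suc by simp
    qed (use none in fastforce)
    from this[of "j - i - 1"] show False using ge ijk by simp
  qed
  then obtain t where t: "i \<le> t" "t < j" "a (Suc t) \<le> a t" by blast
  \<comment> \<open>Once the ratio of consecutive terms is at most one, it is smaller than one from then on.\<close>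
  have fall: "t < s \<Longrightarrow> s < n \<Longrightarrow> a (Suc s) < a s" for s
  proof (induction s)
    case (Suc s)
    have "a (Suc s) \<le> a s"
      using Suc t(3) by (cases "s = t") (auto intro: less_imp_le)
    then have "a (Suc (Suc s)) * a (Suc s) \<le> a (Suc (Suc s)) * a s" by simp
    also have "\<dots> < a (Suc s) * a (Suc s)"
      using lc pos[of "Suc s"] Suc.prems by (simp add: strictly_log_concave_def)
    finally show ?case by simp
  qed simp
  have "j + Suc d \<le> n \<Longrightarrow> a (j + Suc d) < a j" for d
  proof (induction d)
    case 0
    then show ?case using fall[of j] t by simp
  next
    case (Suc d)
    then show ?case using fall[of "j + Suc d"] t by simp
  qed
  from this[of "k - j - 1"] show False using ge ijk by simp
qed

section \<open>Ballot words and the middle binomial coefficient\<close>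

text \<open>
  Words in which, in every prefix, the letters \<open>True\<close> outnumber the letters \<open>False\<close> by at
  most \<open>d\<close>: the parameter is the budget that is left.
\<close>

fun ballot :: "nat \<Rightarrow> bool list \<Rightarrow> bool" where
  "ballot d [] = True"
| "ballot d (False # xs) = ballot (Suc d) xs"
| "ballot d (True # xs) = (case d of 0 \<Rightarrow> False | Suc d' \<Rightarrow> ballot d' xs)"

lemma ballot_if_prefixes:
  assumes "\<And>k. k \<le> length xs \<Longrightarrow>
    length (filter (\<lambda>b. b) (take k xs)) \<le> d + length (filter Not (take k xs))"
  shows "ballot d xs"
  using assms
proof (induction xs arbitrary: d)
  case (Cons x xs)
  have prefix: "length (filter (\<lambda>b. b) (x # take k xs)) \<le> d + length (filter Not (x # take k xs))"
    if "k \<le> length xs" for k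
    using Cons.prems[of "Suc k"] that by simp
  show ?case
  proof (cases x)
    case True
    then obtain d' where d: "d = Suc d'" using prefix[of 0] by (cases d) auto
    have "ballot d' xs" by (rule Cons.IH) (use prefix True d in auto)
    then show ?thesis using True d by simp
  next
    case False
    have "ballot (Suc d) xs" by (rule Cons.IH) (use prefix False in auto)
    then show ?thesis using False by simp
  qed
qed simp

text \<open>
  The argument is an integer so that the Pascal recurrence for these partial row sums and the
  count of ballot words below hold without case distinctions at the left end of the row.
\<close>

definition binomial_sum_below :: "nat \<Rightarrow> int \<Rightarrow> nat" where
  "binomial_sum_below t z = (\<Sum>i<nat z. t choose i)"

lemma binomial_sum_below_Suc:
  "binomial_sum_below (Suc t) z = binomial_sum_below t z + binomial_sum_below t (z - 1)"
proof (cases "z \<le> 0")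
  case False
  define x where "x = nat (z - 1)"
  have z: "nat z = Suc x" "nat (z - 1) = x" using False by (auto simp: x_def)
  have "(\<Sum>i<Suc x. Suc t choose i) = (\<Sum>i<Suc x. t choose i) + (\<Sum>i<x. t choose i)"
    by (induction x) simp_all
  then show ?thesis by (simp only: binomial_sum_below_def z)
qed (simp add: binomial_sum_below_def)

lemma finite_ballot: "finite {xs. length xs = t \<and> ballot d xs}"
  using finite_lists_length_eq[of "UNIV :: bool set" t] by (auto intro: finite_subset[rotated])

lemma card_ballot_Suc:
  "card {xs. length xs = Suc t \<and> ballot d xs} = card {xs. length xs = t \<and> ballot (Suc d) xs} +
     (case d of 0 \<Rightarrow> 0 | Suc d' \<Rightarrow> card {xs. length xs = t \<and> ballot d' xs})"
proof -
  define B where "B d = {xs. length xs = t \<and> ballot d xs}" for d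
  have fin: "finite (B d)" for d by (simp add: B_def finite_ballot)
  have cardC: "card (Cons x ` B d) = card (B d)" for x d by (simp add: card_image)
  have disj: "Cons False ` X \<inter> Cons True ` Y = {}" for X Y by auto
  have "{xs. length xs = Suc t \<and> ballot d xs} =
    Cons False ` B (Suc d) \<union> (case d of 0 \<Rightarrow> {} | Suc d' \<Rightarrow> Cons True ` B d')" (is "?L = ?R")
  proof (rule set_eqI)
    fix xs :: "bool list"
    show "xs \<in> ?L \<longleftrightarrow> xs \<in> ?R"
    proof (cases xs)
      case (Cons x ys)
      then show ?thesis by (cases x; cases d) (auto simp: B_def)
    qed (cases d; auto)
  qed
  then show ?thesis
    using fin disj by (cases d) (simp_all add: card_Un_disjoint cardC flip: B_def)
qed

text \<open>
  By the reflection principle, the ballot words of length \<open>t\<close> with budget \<open>d\<close> are as many as the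
  subsets of a \<open>t\<close>-set whose size lies in a window of \<open>d + 1\<close> consecutive integers around
  \<open>t/2\<close>. With this closed form in hand, the recurrence over the first letter is just the Pascal
  recurrence at both ends of the window; for \<open>d = 0\<close> the window of budget \<open>-1\<close> is empty.
\<close>

lemma card_ballot:
  "card {xs. length xs = t \<and> ballot d xs} + binomial_sum_below t ((int t - int d) div 2) =
   binomial_sum_below t ((int t + int d) div 2 + 1)"
proof (induction t arbitrary: d)
  case 0
  have "{xs. length xs = 0 \<and> ballot d xs} = {[]}" by auto
  moreover have "nat (- int d div 2) = 0" by simp
  moreover have "nat (int d div 2 + 1) = Suc (d div 2)" by simp
  moreover have "(\<Sum>i<Suc k. 0 choose i) = (1::nat)" for k by (induction k) simp_all
  ultimately show ?case by (simp only: binomial_sum_below_def) simp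
next
  case (Suc t)
  show ?case
  proof (cases d)
    case 0
    have "(int t - 1) div 2 = (1 + int t) div 2 - 1" by simp
    then show ?thesis
      using Suc.IH[of 1] 0
      by (simp add: card_ballot_Suc binomial_sum_below_Suc add.commute)
  next
    case (Suc d')
    define y z where "y = (int t + int d') div 2 + 1" and "z = (int t - int d') div 2"
    have ends: "(int (Suc t) + int d) div 2 + 1 = y + 1" "(int (Suc t) - int d) div 2 = z"
      "(int t + int (Suc d)) div 2 + 1 = y + 1" "(int t - int (Suc d)) div 2 = z - 1"
      using Suc by (auto simp: y_def z_def)
    show ?thesis
      using Suc.IH[of "Suc d"] Suc.IH[of d']
      unfolding card_ballot_Suc binomial_sum_below_Suc ends y_def[symmetric] z_def[symmetric]
      by (simp add: Suc)
  qed
qed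

lemma card_ballot_2_le:
  "card {xs. length xs = t \<and> ballot 2 xs} \<le> 3 * (t choose (t div 2))"
proof -
  define h where "h = t div 2"
  define b where "b i = t choose i" for i
  have max: "b i \<le> b h" for i
    using binomial_maximum by (simp add: b_def h_def)
  have "(int t + int 2) div 2 + 1 = int (h + 2)" "(int t - int 2) div 2 = int h - 1"
    unfolding h_def by auto
  then have "card {xs. length xs = t \<and> ballot 2 xs} + (\<Sum>i<h - 1. t choose i) = (\<Sum>i<h + 2. t choose i)"
    using card_ballot[of t 2] unfolding binomial_sum_below_def
    by (metis nat_int nat_minus_as_int of_nat_1)
  also have "\<dots> \<le> (\<Sum>i<h - 1. t choose i) + 3 * (t choose h)"
    unfolding b_def[symmetric]
  proof (cases h)
    case 0
    then show "(\<Sum>i<h + 2. b i) \<le> (\<Sum>i<h - 1. b i) + 3 * b h"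
      using max[of 0] max[of "Suc 0"] by simp
  next
    case (Suc l)
    then show "(\<Sum>i<h + 2. b i) \<le> (\<Sum>i<h - 1. b i) + 3 * b h"
      using max[of l] max[of "Suc h"] by simp
  qed
  finally show ?thesis by (simp add: h_def)
qed

text \<open>
  This form, rather than \<open>(2k choose k)\<^sup>2 k \<le> 16\<^sup>k\<close>, goes through by induction: the step
  multiplies the left side by \<open>4 (2k + 1) (2k + 3) / (k + 1)\<^sup>2\<close>, which is at most \<open>16\<close>.
\<close>

lemma central_binomial_squared_le: "((2 * k) choose k)\<^sup>2 * (2 * k + 1) \<le> 16 ^ k"
proof (induction k)
  case (Suc k)
  define c where "c = (2 * k) choose k"
  define c' where "c' = (2 * Suc k) choose Suc k"
  have rec: "c' * Suc k = 2 * (2 * k + 1) * c"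
  proof -
    have "Suc k * c' = (2 * k + 2) * ((2 * k + 1) choose k)"
      using Suc_times_binomial[of k "2 * k + 1"] by (simp add: c'_def)
    also have "(2 * k + 1) choose k = (2 * k + 1) choose Suc k"
      using binomial_symmetric[of k "2 * k + 1"] by simp
    also have "(2 * k + 2) * \<dots> = 2 * (Suc k * (Suc (2 * k) choose Suc k))" by simp
    also have "Suc k * (Suc (2 * k) choose Suc k) = Suc (2 * k) * c"
      using Suc_times_binomial[of k "2 * k"] by (simp add: c_def)
    finally show ?thesis by (simp add: mult.commute)
  qed
  have "(c'\<^sup>2 * (2 * Suc k + 1)) * (Suc k)\<^sup>2 = (c' * Suc k)\<^sup>2 * (2 * k + 3)"
  proof -
    have "2 * Suc k + 1 = 2 * k + 3" by simp
    then show ?thesis by (simp only: power_mult_distrib ac_simps)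
  qed
  also have "\<dots> = 4 * ((2 * k + 1) * (2 * k + 3)) * (c\<^sup>2 * (2 * k + 1))"
    unfolding rec by (simp add: power2_eq_square algebra_simps)
  also have "\<dots> \<le> 4 * (4 * (Suc k)\<^sup>2) * 16 ^ k"
  proof -
    have "(2 * k + 1) * (2 * k + 3) \<le> 4 * (Suc k)\<^sup>2"
      by (simp add: power2_eq_square algebra_simps)
    moreover have "c\<^sup>2 * (2 * k + 1) \<le> 16 ^ k" using Suc.IH by (simp only: c_def)
    ultimately show ?thesis by (meson mult_le_mono order_refl)
  qed
  also have "\<dots> = 16 ^ Suc k * (Suc k)\<^sup>2" by simp
  finally show ?case unfolding c'_def by simp
qed simp

lemma middle_binomial_le:
  assumes "n \<ge> 1"
  shows "real (n choose (n div 2)) \<le> 2 ^ n / sqrt (real n)"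
proof -
  have "(n choose (n div 2))\<^sup>2 * n \<le> 4 ^ n"
  proof (cases "even n")
    case True
    then obtain k where n: "n = 2 * k" by blast
    have "((2 * k) choose k)\<^sup>2 * (2 * k) \<le> 16 ^ k"
      using central_binomial_squared_le[of k] by simp
    also have "(16::nat) ^ k = 4 ^ (2 * k)" by (simp add: power_mult)
    finally show ?thesis by (simp add: n)
  next
    case False
    then obtain k where n: "n = 2 * k + 1" by (auto elim: oddE)
    have "(2 * Suc k) choose Suc k = 2 * ((2 * k + 1) choose k)"
      using binomial_symmetric[of k "2 * k + 1"] by simp
    then have "4 * (((2 * k + 1) choose k)\<^sup>2 * (2 * k + 3)) \<le> 16 ^ Suc k"
      using central_binomial_squared_le[of "Suc k"] by (simp add: power2_eq_square algebra_simps)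
    moreover have "(16::nat) ^ Suc k = 4 * 4 ^ (2 * k + 1)" by (simp add: power_mult)
    ultimately have "((2 * k + 1) choose k)\<^sup>2 * (2 * k + 3) \<le> 4 ^ (2 * k + 1)" by linarith
    then have "((2 * k + 1) choose k)\<^sup>2 * (2 * k + 1) \<le> 4 ^ (2 * k + 1)"
      by (rule order_trans[rotated]) (rule mult_left_mono, simp_all)
    then show ?thesis by (simp add: n)
  qed
  then have *: "real ((n choose (n div 2))\<^sup>2 * n) \<le> real (4 ^ n)" by (rule of_nat_mono)
  have "(real (n choose (n div 2)) * sqrt (real n))\<^sup>2 \<le> (2 ^ n)\<^sup>2"
  proof -
    have "(2 ^ n)\<^sup>2 = (4::real) ^ n" by (simp add: power2_eq_square flip: power_mult_distrib)
    then show ?thesis using * by (simp add: power_mult_distrib)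
  qed
  then have "real (n choose (n div 2)) * sqrt (real n) \<le> 2 ^ n"
    by (rule power2_le_imp_le) simp
  then show ?thesis using assms by (simp add: field_simps)
qed

section \<open>Encoding matching permutations by ballot words\<close>

text \<open>
  What the inequalities between matching numbers say about a matching permutation, read as a list
  of the indices by increasing matching number. The second clause is unimodality: no index is
  listed before both an index on its left and one on its right. The third clause tilts the shape:
  of two indices whose midpoint is less than \<open>n/2\<close>, the smaller one is listed first.
\<close>

definition tilted_unimodal :: "nat \<Rightarrow> (nat \<Rightarrow> nat) \<Rightarrow> bool" where
  "tilted_unimodal n \<pi> \<longleftrightarrow> \<pi> permutes {1..n} \<and>
     (\<forall>r\<in>{1..n}. \<forall>s\<in>{1..n}. \<forall>t\<in>{1..n}. \<pi> r < \<pi> s \<and> \<pi> s < \<pi> t \<longrightarrow> r < s \<or> t < s) \<and>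
     (\<forall>s\<in>{1..n}. \<forall>t\<in>{1..n}. \<pi> s < \<pi> t \<and> \<pi> s + \<pi> t < n \<longrightarrow> s < t)"

lemma tilted_unimodal_peak:
  assumes "tilted_unimodal n \<pi>" "r \<in> {1..n}" "s \<in> {1..n}" "t \<in> {1..n}" "\<pi> r < \<pi> s" "\<pi> s < \<pi> t"
  shows "r < s \<or> t < s"
  using assms by (simp add: tilted_unimodal_def)

lemma permutes_interval_less_imageE:
  fixes \<pi> :: "nat \<Rightarrow> nat"
  assumes "\<pi> permutes {1..n}" "y \<in> {1..n}"
  obtains s where "s \<in> {1..n}" "\<pi> s = y"
  using permutes_image[OF assms(1)] assms(2) by (metis imageE)

text \<open>
  The last listed index \<open>\<pi> n\<close> is the peak. By unimodality the indices on its right are listed in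
  the order \<open>n, n - 1, \<dots>\<close>, and those on its left in the order \<open>1, 2, \<dots>\<close>. So the side on which
  each listed index lies determines the permutation.
\<close>

lemma value_right_of_peak:
  assumes \<pi>: "tilted_unimodal n \<pi>" and t: "t \<in> {1..n}" "\<pi> n < \<pi> t"
  shows "\<pi> t + card {s\<in>{1..<t}. \<pi> n < \<pi> s} = n"
proof -
  have perm: "\<pi> permutes {1..n}" using \<pi> by (simp add: tilted_unimodal_def)
  note inj = permutes_inj[OF perm]
  have range: "\<pi> s \<in> {1..n}" if "s \<in> {1..n}" for s
    using permutes_in_image[OF perm] that by blast
  have n: "n \<in> {1..n}" using t by auto
  have "\<pi> ` {s\<in>{1..<t}. \<pi> n < \<pi> s} = {\<pi> t<..n}"
  proof (intro equalityI subsetI)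
    fix y assume "y \<in> \<pi> ` {s\<in>{1..<t}. \<pi> n < \<pi> s}"
    then obtain s where s: "1 \<le> s" "s < t" "\<pi> n < \<pi> s" "y = \<pi> s" by auto
    then have sn: "s \<in> {1..n}" using t by auto
    have "\<pi> s \<noteq> \<pi> t" using inj s by (auto dest: injD)
    moreover have "\<not> \<pi> s < \<pi> t"
      using tilted_unimodal_peak[OF \<pi> n sn t(1)] s t by auto
    ultimately show "y \<in> {\<pi> t<..n}" using range[OF sn] s by auto
  next
    fix y assume y: "y \<in> {\<pi> t<..n}"
    then obtain s where s: "s \<in> {1..n}" "\<pi> s = y"
      using permutes_interval_less_imageE[OF perm, of y] by auto
    have "s < t"
      using tilted_unimodal_peak[OF \<pi> n t(1) s(1)] s y t by auto
    then show "y \<in> \<pi> ` {s\<in>{1..<t}. \<pi> n < \<pi> s}" using s y t by auto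
  qed
  then have "card {s\<in>{1..<t}. \<pi> n < \<pi> s} = n - \<pi> t"
    using card_image[OF inj_on_subset[OF inj subset_UNIV], of "{s\<in>{1..<t}. \<pi> n < \<pi> s}"] by simp
  then show ?thesis using range[OF t(1)] by simp
qed

lemma value_left_of_peak:
  assumes \<pi>: "tilted_unimodal n \<pi>" and t: "t \<in> {1..n}" "\<not> \<pi> n < \<pi> t"
  shows "\<pi> t = Suc (card {s\<in>{1..<t}. \<not> \<pi> n < \<pi> s})"
proof -
  have perm: "\<pi> permutes {1..n}" using \<pi> by (simp add: tilted_unimodal_def)
  note inj = permutes_inj[OF perm]
  have range: "\<pi> s \<in> {1..n}" if "s \<in> {1..n}" for s
    using permutes_in_image[OF perm] that by blast
  have n: "n \<in> {1..n}" using t by auto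
  have "\<pi> ` {s\<in>{1..<t}. \<not> \<pi> n < \<pi> s} = {1..<\<pi> t}"
  proof (intro equalityI subsetI)
    fix y assume "y \<in> \<pi> ` {s\<in>{1..<t}. \<not> \<pi> n < \<pi> s}"
    then obtain s where s: "1 \<le> s" "s < t" "\<not> \<pi> n < \<pi> s" "y = \<pi> s" by auto
    then have sn: "s \<in> {1..n}" "s \<noteq> n" using t by auto
    have ne: "\<pi> s \<noteq> \<pi> t" "\<pi> s \<noteq> \<pi> n" using inj s sn by (auto dest: injD)
    then have "\<not> \<pi> t < \<pi> s"
      using tilted_unimodal_peak[OF \<pi> t(1) sn(1) n] s t by auto
    then show "y \<in> {1..<\<pi> t}" using range[OF sn(1)] s ne by auto
  next
    fix y assume y: "y \<in> {1..<\<pi> t}"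
    then obtain s where s: "s \<in> {1..n}" "\<pi> s = y"
      using permutes_interval_less_imageE[OF perm, of y] range[OF t(1)] by auto
    have "s < t"
    proof (cases "t = n")
      case True
      then show ?thesis using s y by (cases "s = n") auto
    next
      case False
      then have "\<pi> t \<noteq> \<pi> n" using inj by (auto dest: injD)
      then show ?thesis using tilted_unimodal_peak[OF \<pi> s(1) t(1) n] s y t by auto
    qed
    then show "y \<in> \<pi> ` {s\<in>{1..<t}. \<not> \<pi> n < \<pi> s}" using s y t by auto
  qed
  then have "card {s\<in>{1..<t}. \<not> \<pi> n < \<pi> s} = \<pi> t - 1"
    using card_image[OF inj_on_subset[OF inj subset_UNIV], of "{s\<in>{1..<t}. \<not> \<pi> n < \<pi> s}"] by simp
  then show ?thesis using range[OF t(1)] by simp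
qed

text \<open>
  It suffices to look at a position \<open>t\<close> where an index on the right is listed. If \<open>r\<close> right and
  \<open>l\<close> left indices come before, then this index is \<open>n - r\<close>, and the next left index to be
  listed, \<open>l + 1\<close>, comes later although it is smaller. The tilt therefore forces
  \<open>(n - r) + (l + 1) \<ge> n\<close>, that is \<open>r + 1 \<le> l + 2\<close>.
\<close>

lemma card_right_le_card_left:
  assumes \<pi>: "tilted_unimodal n \<pi>" and "k \<le> n"
  shows "card {s\<in>{1..<Suc k}. \<pi> n < \<pi> s} \<le> 2 + card {s\<in>{1..<Suc k}. \<not> \<pi> n < \<pi> s}"
  using \<open>k \<le> n\<close>
proof (induction k)
  case (Suc k)
  define t where "t = Suc k"
  have t: "t \<in> {1..n}" using Suc.prems by (auto simp: t_def)
  show ?case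
  proof (cases "\<pi> n < \<pi> t")
    case False
    then have "{s\<in>{1..<Suc t}. \<pi> n < \<pi> s} = {s\<in>{1..<t}. \<pi> n < \<pi> s}"
      by (auto simp: less_Suc_eq)
    moreover have "card {s\<in>{1..<t}. \<not> \<pi> n < \<pi> s} \<le> card {s\<in>{1..<Suc t}. \<not> \<pi> n < \<pi> s}"
      by (intro card_mono) auto
    ultimately show ?thesis using Suc by (simp add: t_def)
  next
    case True
    (* The position of the next index on the left. *)
    define t' where "t' = (LEAST t'. t < t' \<and> \<not> \<pi> n < \<pi> t')"
    have "t \<noteq> n" using True by auto
    then have ex: "t < n \<and> \<not> \<pi> n < \<pi> n" using t by auto
    have t': "t < t'" "\<not> \<pi> n < \<pi> t'" using LeastI[of "\<lambda>t'. t < t' \<and> \<not> \<pi> n < \<pi> t'", OF ex]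
      by (auto simp: t'_def)
    have "t' \<le> n" unfolding t'_def using ex by (rule Least_le)
    then have t'n: "t' \<in> {1..n}" using t' by auto
    have "\<pi> n < \<pi> s" if "t \<le> s" "s < t'" for s
      using not_less_Least[of s "\<lambda>t'. t < t' \<and> \<not> \<pi> n < \<pi> t'"] that True
      by (cases "s = t") (auto simp: t'_def)
    then have left_eq: "{s\<in>{1..<t'}. \<not> \<pi> n < \<pi> s} = {s\<in>{1..<t}. \<not> \<pi> n < \<pi> s}"
      using t' by (auto simp: not_less) (meson leD leI)
    have "\<pi> t' < \<pi> t" using True t' by auto
    then have "\<not> \<pi> t' + \<pi> t < n"
      using \<pi> t t'n t' unfolding tilted_unimodal_def by (meson less_asym)
    then have "card {s\<in>{1..<t}. \<pi> n < \<pi> s} \<le> Suc (card {s\<in>{1..<t}. \<not> \<pi> n < \<pi> s})"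
      using value_right_of_peak[OF \<pi> t True] value_left_of_peak[OF \<pi> t'n t'(2)] left_eq by simp
    moreover have "{s\<in>{1..<Suc t}. \<pi> n < \<pi> s} = insert t {s\<in>{1..<t}. \<pi> n < \<pi> s}"
      using True t by (auto simp: less_Suc_eq)
    moreover have "{s\<in>{1..<Suc t}. \<not> \<pi> n < \<pi> s} = {s\<in>{1..<t}. \<not> \<pi> n < \<pi> s}"
      using True by (auto simp: less_Suc_eq)
    ultimately show ?thesis by (simp add: t_def)
  qed
qed simp

definition side_word :: "nat \<Rightarrow> (nat \<Rightarrow> nat) \<Rightarrow> bool list" where
  "side_word n \<pi> = map (\<lambda>t. \<pi> n < \<pi> t) [1..<Suc n]"

lemma ballot_side_word:
  assumes "tilted_unimodal n \<pi>"
  shows "ballot 2 (side_word n \<pi>)"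
proof (rule ballot_if_prefixes)
  fix k assume "k \<le> length (side_word n \<pi>)"
  then have k: "k \<le> n" by (simp add: side_word_def del: upt_Suc)
  then have take: "take k (side_word n \<pi>) = map (\<lambda>t. \<pi> n < \<pi> t) [1..<Suc k]"
    unfolding side_word_def take_map by (subst take_upt) simp_all
  have "length (filter P (map f [1..<m])) = card {s\<in>{1..<m}. P (f s)}" for P and f :: "nat \<Rightarrow> bool" and m
    by (simp add: filter_map distinct_length_filter Int_def conj_commute)
  then show "length (filter (\<lambda>b. b) (take k (side_word n \<pi>)))
      \<le> 2 + length (filter Not (take k (side_word n \<pi>)))"
    unfolding take using card_right_le_card_left[OF assms k] by (simp only:)
qed

lemma inj_on_side_word: "inj_on (side_word n) {\<pi>. tilted_unimodal n \<pi>}"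
proof (intro inj_onI ext)
  fix \<pi> \<rho> t
  assume "\<pi> \<in> {\<pi>. tilted_unimodal n \<pi>}" "\<rho> \<in> {\<pi>. tilted_unimodal n \<pi>}"
    and word: "side_word n \<pi> = side_word n \<rho>"
  then have \<pi>: "tilted_unimodal n \<pi>" and \<rho>: "tilted_unimodal n \<rho>" by auto
  have same: "\<pi> n < \<pi> s \<longleftrightarrow> \<rho> n < \<rho> s" if "s \<in> {1..n}" for s
    using word that unfolding side_word_def by (auto simp: map_eq_conv simp del: upt_Suc)
  show "\<pi> t = \<rho> t"
  proof (cases "t \<in> {1..n}")
    case True
    then have "{s\<in>{1..<t}. \<pi> n < \<pi> s} = {s\<in>{1..<t}. \<rho> n < \<rho> s}"
      "{s\<in>{1..<t}. \<not> \<pi> n < \<pi> s} = {s\<in>{1..<t}. \<not> \<rho> n < \<rho> s}"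
      using same by auto
    then show ?thesis
      using value_right_of_peak[OF \<pi> True] value_right_of_peak[OF \<rho> True]
        value_left_of_peak[OF \<pi> True] value_left_of_peak[OF \<rho> True] same[OF True]
      by (cases "\<pi> n < \<pi> t") auto
  next
    case False
    then show ?thesis
      using \<pi> \<rho> unfolding tilted_unimodal_def by (metis permutes_not_in)
  qed
qed

lemma card_tilted_unimodal_le:
  "card {\<pi>. tilted_unimodal n \<pi>} \<le> 3 * (n choose (n div 2))"
proof -
  have "card {\<pi>. tilted_unimodal n \<pi>} \<le> card {xs. length xs = n \<and> ballot 2 xs}"
    by (rule card_inj_on_le[OF inj_on_side_word _ finite_ballot])
      (auto simp: ballot_side_word, simp add: side_word_def)
  also have "\<dots> \<le> 3 * (n choose (n div 2))" by (rule card_ballot_2_le)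
  finally show ?thesis .
qed

section \<open>The bound\<close>

text \<open>
  Both inequalities between matching numbers are strict, so they fix the order of the indices
  concerned in spite of possible ties elsewhere.
\<close>

lemma matching_permutation_imp_tilted_unimodal:
  assumes G: "simple_graph V E" and n: "matching_number E = n" and perm: "matching_permutation E \<pi>"
  shows "tilted_unimodal n \<pi>"
proof -
  have two: "\<And>e. e \<in> E \<Longrightarrow> card e = 2" and "finite V" and EV: "E \<subseteq> Pow V"
    using G by (auto simp: simple_graph_def)
  then have fin: "finite E" by (meson finite_Pow_iff finite_subset)
  have "finite {M. matching E M}" "matching E {}"
    using finite_matchings[OF fin, of "\<lambda>_. True"] by (auto simp: matching_def)
  then have "n \<in> {card M | M. matching E M}"
    unfolding n[symmetric] matching_number_def by (intro Max_in) auto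
  then obtain N where N: "matching E N" "card N = n" by auto
  define m where "m = num_matchings E"
  have pos: "m t > 0" if "t \<le> n" for t
    using num_matchings_pos_iff[OF fin, of n] num_matchings_pos_le[OF fin _ that] N
    by (auto simp: m_def)
  have "induced E V = E" using EV by (auto simp: induced_def)
  then have lc: "strictly_log_concave m"
    using num_matchings_interlacing[OF fin two \<open>finite V\<close>] by (simp add: m_def)
  have \<pi>: "\<pi> permutes {1..n}" "mono_on {1..n} (\<lambda>t. m (\<pi> t))"
    using perm n by (auto simp: matching_permutation_def m_def)
  have later: "s < t" if "m (\<pi> s) < m (\<pi> t)" "s \<in> {1..n}" "t \<in> {1..n}" for s t
    using that mono_onD[OF \<pi>(2), of t s] by (meson leD leI)
  have le_n: "\<pi> t \<le> n" if "t \<in> {1..n}" for t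
    using permutes_in_image[OF \<pi>(1), of t] that by auto
  show ?thesis
    unfolding tilted_unimodal_def
  proof (intro conjI ballI impI)
    fix r s t assume *: "r \<in> {1..n}" "s \<in> {1..n}" "t \<in> {1..n}" "\<pi> r < \<pi> s \<and> \<pi> s < \<pi> t"
    have "m (\<pi> r) < m (\<pi> s) \<or> m (\<pi> t) < m (\<pi> s)"
      by (rule strictly_log_concave_imp_unimodal[where n = n]) (use lc pos le_n * in auto)
    then show "r < s \<or> t < s" using later * by blast
  next
    fix s t assume *: "s \<in> {1..n}" "t \<in> {1..n}" "\<pi> s < \<pi> t \<and> \<pi> s + \<pi> t < n"
    then have "m (\<pi> s) < m (\<pi> t)"
      unfolding m_def by (intro num_matchings_less_reflected[OF fin two N]) auto
    then show "s < t" using later * by blast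
  qed (rule \<pi>(1))
qed

lemma num_matching_perms_le:
  assumes "n \<ge> 1"
  shows "real (num_matching_perms n) \<le> 3 * 2 ^ n / sqrt (real n)"
proof -
  have "matching_perms n \<subseteq> {\<pi>. tilted_unimodal n \<pi>}"
    unfolding matching_perms_def using matching_permutation_imp_tilted_unimodal by blast
  moreover have "finite {\<pi>. tilted_unimodal n \<pi>}"
    by (rule finite_subset[OF _ finite_permutations[of "{1..n}"]]) (auto simp: tilted_unimodal_def)
  ultimately have "num_matching_perms n \<le> 3 * (n choose (n div 2))"
    unfolding num_matching_perms_def using card_mono card_tilted_unimodal_le le_trans by metis
  then have "real (num_matching_perms n) \<le> 3 * real (n choose (n div 2))" by linarith
  also have "\<dots> \<le> 3 * (2 ^ n / sqrt (real n))" using middle_binomial_le[OF assms] by simp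
  finally show ?thesis by simp
qed

theorem theorem1p7:
  shows "(\<lambda>n. real (num_matching_perms n)) \<in> o(\<lambda>n. 2 ^ n) \<and>
         (\<exists>c::real. \<forall>n::nat. n \<ge> 1 \<longrightarrow> real (num_matching_perms n) \<le> c * 2 ^ n / sqrt (real n))"
proof
  have lim: "(\<lambda>n. 3 / sqrt (real n)) \<longlonglongrightarrow> 0"
    by (intro tendsto_divide_0[OF tendsto_const] filterlim_at_top_imp_at_infinity
        filterlim_compose[OF sqrt_at_top] filterlim_real_sequentially)
  have "(\<lambda>n. real (num_matching_perms n) / 2 ^ n) \<longlonglongrightarrow> 0"
  proof (rule tendsto_sandwich[OF _ _ tendsto_const lim])
    show "\<forall>\<^sub>F n in sequentially. real (num_matching_perms n) / 2 ^ n \<le> 3 / sqrt (real n)"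
      using eventually_ge_at_top[of 1]
    proof eventually_elim
      case (elim n)
      then show ?case using num_matching_perms_le[of n] by (simp add: field_simps)
    qed
  qed simp
  then show "(\<lambda>n. real (num_matching_perms n)) \<in> o(\<lambda>n. 2 ^ n)"
    by (intro smalloI_tendsto) auto
  show "\<exists>c::real. \<forall>n::nat. n \<ge> 1 \<longrightarrow> real (num_matching_perms n) \<le> c * 2 ^ n / sqrt (real n)"
    using num_matching_perms_le by blast
qed

end
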